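(* Let $k\in\{2,3\}$ and let $G$ be a $k$-cactus with $n$ vertices. Then $|E(G)|\le \left\lfloor \frac{(2k+1)(n-1)}{k+1}\right\rfloor$. Moreover, this bound is tight: for each $k\in\{2,3\}$ and each $n\ge 1$ there is a $k$-cactus with $n$ vertices and exactly $\left\lfloor \frac{(2k+1)(n-1)}{k+1}\right\rfloor$ edges.
   Context: All graphs are finite and simple. For an integer $k\ge 1$, a $k$-cactus is a connected graph in which every edge is contained in at most $k$ cycles. *)

theory Defs
  imports Complex_Main
begin

definition simple_graph :: "'a set \<Rightarrow> 'a set set \<Rightarrow> bool" where
  "simple_graph V E \<longleftrightarrow> finite V \<and> (\<forall>e\<in>E. e \<subseteq> V \<and> card e = 2)"

(* The null graph does not count as connected. *)
definition connected_graph :: "'a set \<Rightarrow> 'a set set \<Rightarrow> bool" where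
  "connected_graph V E \<longleftrightarrow>
     V \<noteq> {} \<and> (\<forall>u\<in>V. \<forall>v\<in>V. (u, v) \<in> {(x, y). {x, y} \<in> E}\<^sup>*)"

(* xs is read cyclically: its last vertex is joined to its first. *)
definition cycle_edges :: "'a list \<Rightarrow> 'a set set" where
  "cycle_edges xs = {{xs ! i, xs ! (Suc i mod length xs)} | i. i < length xs}"

(* A cycle is a subgraph, represented by its edge set, so that rotations and
   reversals of one closed vertex sequence are counted only once. *)
definition cycles :: "'a set set \<Rightarrow> 'a set set set" where
  "cycles E = {C. C \<subseteq> E \<and> (\<exists>xs. 3 \<le> length xs \<and> distinct xs \<and> C = cycle_edges xs)}"

definition k_cactus :: "nat \<Rightarrow> 'a set \<Rightarrow> 'a set set \<Rightarrow> bool" where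
  "k_cactus k V E \<longleftrightarrow>
     simple_graph V E \<and> connected_graph V E \<and>
     (\<forall>e\<in>E. card {C \<in> cycles E. e \<in> C} \<le> k)"

end

theory Submission
  imports Defs "HOL-Library.Transitive_Closure_Table"
begin

text \<open>
  Call an edge set even if it has even degree at every vertex; every edge of an even set lies on a
  cycle inside that set. Fix a maximal forest \<open>T\<close>. An even set is determined by its chords, that is,
  its edges outside \<open>T\<close>, and every chord \<open>f\<close> has a fundamental cycle, which consists of \<open>f\<close> and a path
  \<open>P f\<close> in \<open>T\<close>. If \<open>P f\<close> meets \<open>P g\<close>, then the symmetric difference of the two fundamental cycles is
  again a cycle through \<open>f\<close>. Hence \<open>f\<close> meets at most \<open>k - 1\<close> others, and for \<open>k\<close> at most 3 a fourth
  cycle through \<open>f\<close> appears unless meeting is transitive. The classes of this equivalence thus have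
  some size \<open>s\<close> with \<open>s \<le> k\<close>, and the paths of one class cover at least \<open>s + 1\<close> edges of \<open>T\<close>, while
  different classes cover disjoint sets. So \<open>(k + 1) * card (E - T) \<le> k * card T\<close>, which is the bound.

  Equality is attained by a vertex joined to all vertices of a disjoint union of stars with at most
  \<open>k\<close> leaves each.
\<close>

section \<open>Even edge sets and cycles\<close>

lemma odd_card_sym_diff_iff:
  assumes "finite A" "finite B"
  shows "odd (card (sym_diff A B)) \<longleftrightarrow> odd (card A) \<noteq> odd (card B)"
proof -
  have "card A = card (A - B) + card (A \<inter> B)" "card B = card (B - A) + card (A \<inter> B)"
    using assms card_Int_Diff[of A B] card_Int_Diff[of B A] by (simp_all add: Int_commute)
  moreover have "card (sym_diff A B) = card (A - B) + card (B - A)"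
    using assms by (intro card_Un_disjoint) auto
  ultimately show ?thesis by auto
qed

text \<open>
  If the symmetric difference were the whole union, any two of the sets would differ in exactly one
  element; but of three sets, an even number of pairs differ in an odd number of elements.
\<close>

lemma card_sym_diff_three_le_2:
  assumes fin: "finite X" "finite Y" "finite Z"
    and distinct: "X \<noteq> Y" "X \<noteq> Z" "Y \<noteq> Z"
    and card_ge_2: "2 \<le> card X" "2 \<le> card Y" "2 \<le> card Z"
    and card_Un: "card (X \<union> Y \<union> Z) \<le> 3"
  shows "card (sym_diff (sym_diff X Y) Z) \<le> 2"
proof (rule ccontr)
  assume "\<not> ?thesis"
  then have sum_eq: "sym_diff (sym_diff X Y) Z = X \<union> Y \<union> Z"
    using card_Un fin by (intro card_seteq) auto
  have card_sym_diff_1: "card (sym_diff P Q) = 1"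
    if finite: "finite P" "finite Q" "finite R" and "P \<noteq> Q" "2 \<le> card R"
      and subset: "R \<union> sym_diff P Q \<subseteq> X \<union> Y \<union> Z"
      and disjoint: "R \<inter> sym_diff P Q = {}"
    for P Q R
  proof -
    have "card R + card (sym_diff P Q) = card (R \<union> sym_diff P Q)"
      using finite disjoint by (simp add: card_Un_disjoint)
    also have "\<dots> \<le> card (X \<union> Y \<union> Z)" using fin subset by (intro card_mono) simp_all
    finally have "card (sym_diff P Q) \<le> 1" using card_Un \<open>2 \<le> card R\<close> by linarith
    moreover have "card (sym_diff P Q) \<noteq> 0" using finite \<open>P \<noteq> Q\<close> by auto
    ultimately show ?thesis by linarith
  qed
  have "card (sym_diff X Y) = 1"
    using fin distinct(1) card_ge_2(3) sum_eq by (intro card_sym_diff_1[of X Y Z]) blast+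
  moreover have "card (sym_diff X Z) = 1"
    using fin distinct(2) card_ge_2(2) sum_eq by (intro card_sym_diff_1[of X Z Y]) blast+
  moreover have "card (sym_diff Y Z) = 1"
    using fin distinct(3) card_ge_2(1) sum_eq by (intro card_sym_diff_1[of Y Z X]) blast+
  moreover have "sym_diff (sym_diff X Y) (sym_diff X Z) = sym_diff Y Z" by blast
  ultimately show False
    using odd_card_sym_diff_iff[of "sym_diff X Y" "sym_diff X Z"] fin by simp
qed

definition degree :: "'a set set \<Rightarrow> 'a \<Rightarrow> nat" where
  "degree A v = card {e \<in> A. v \<in> e}"

lemma degree_eq_0_if_not_incident:
  assumes "\<And>e. e \<in> A \<Longrightarrow> v \<notin> e"
  shows "degree A v = 0"
proof -
  have "{e \<in> A. v \<in> e} = {}" using assms by blast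
  then show ?thesis unfolding degree_def by (metis card.empty)
qed

definition even_degrees :: "'a set set \<Rightarrow> bool" where
  "even_degrees A \<longleftrightarrow> (\<forall>v. even (degree A v))"

lemma odd_degree_sym_diff_iff:
  assumes "finite A" "finite B"
  shows "odd (degree (sym_diff A B) v) \<longleftrightarrow> odd (degree A v) \<noteq> odd (degree B v)"
proof -
  have "{e \<in> sym_diff A B. v \<in> e} = sym_diff {e \<in> A. v \<in> e} {e \<in> B. v \<in> e}" by auto
  then show ?thesis
    unfolding degree_def using assms by (simp add: odd_card_sym_diff_iff)
qed

lemma even_degrees_sym_diff:
  assumes "finite A" "finite B" "even_degrees A" "even_degrees B"
  shows "even_degrees (sym_diff A B)"
  using assms odd_degree_sym_diff_iff[OF assms(1,2)] unfolding even_degrees_def by simp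

lemma even_degrees_Diff:
  assumes "finite A" "even_degrees A" "B \<subseteq> A" "even_degrees B"
  shows "even_degrees (A - B)"
proof -
  have "sym_diff A B = A - B" using assms(3) by blast
  then show ?thesis
    using even_degrees_sym_diff[OF assms(1) finite_subset[OF assms(3,1)] assms(2,4)] by simp
qed

lemma even_degrees_ex_other_edge:
  assumes "even_degrees A" "e \<in> A" "v \<in> e"
  obtains e' where "e' \<in> A" "e' \<noteq> e" "v \<in> e'"
proof -
  have "even (card {e \<in> A. v \<in> e})"
    using assms(1) unfolding even_degrees_def degree_def by blast
  then have "{e \<in> A. v \<in> e} \<noteq> {e}" by force
  then show thesis using assms(2,3) that by blast
qed

lemma simple_graph_subset: "simple_graph V E \<Longrightarrow> A \<subseteq> E \<Longrightarrow> simple_graph V A"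
  unfolding simple_graph_def by (meson subsetD)

lemma simple_graph_finite_edges: "simple_graph V E \<Longrightarrow> finite E"
  unfolding simple_graph_def by (metis PowI finite_Pow_iff rev_finite_subset subsetI)

lemma simple_graph_edgeE:
  assumes "simple_graph V E" "e \<in> E"
  obtains u v where "e = {u, v}" "u \<noteq> v" "u \<in> V" "v \<in> V"
proof -
  have e: "e \<subseteq> V" "card e = 2" using assms unfolding simple_graph_def by auto
  then obtain u v where "e = {u, v}" "u \<noteq> v" by (meson card_2_iff)
  then show thesis using that e(1) by simp
qed

lemma simple_graph_incident_edgeE:
  assumes "simple_graph V E" "e \<in> E" "v \<in> e"
  obtains w where "e = {v, w}" "v \<noteq> w"
proof -
  obtain x y where "e = {x, y}" "x \<noteq> y" using simple_graph_edgeE[OF assms(1,2)] .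
  then show thesis using that[of x] that[of y] assms(3) by auto
qed

lemma even_card_odd_degree_vertices:
  assumes "simple_graph V E"
  shows "even (card {v \<in> V. odd (degree E v)})"
proof -
  have V: "finite V" and E: "\<And>e. e \<in> E \<Longrightarrow> e \<subseteq> V \<and> card e = 2"
    using assms unfolding simple_graph_def by auto
  have "(\<Sum>v\<in>V. degree E v) = (\<Sum>e\<in>E. card {v \<in> V. v \<in> e})"
    using sum.swap_restrict[OF V simple_graph_finite_edges[OF assms],
        of "\<lambda>_ _. 1 :: nat" "\<lambda>v e. v \<in> e"]
    by (simp add: degree_def)
  also have "\<dots> = (\<Sum>e\<in>E. 2)"
  proof (rule sum.cong)
    fix e assume "e \<in> E"
    then have "{v \<in> V. v \<in> e} = e" "card e = 2" using E by auto
    then show "card {v \<in> V. v \<in> e} = 2" by simp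
  qed simp
  finally have "even (\<Sum>v\<in>V. degree E v)" by simp
  then show ?thesis by (simp add: even_sum_iff V)
qed

lemma degree_eq_0:
  assumes "simple_graph V E" "v \<notin> V"
  shows "degree E v = 0"
  using assms by (intro degree_eq_0_if_not_incident) (auto simp: simple_graph_def)

lemma even_degrees_if_even_off_vertex:
  assumes "simple_graph V E" "\<And>v. v \<in> V - {r} \<Longrightarrow> even (degree E v)"
  shows "even_degrees E"
proof -
  have "{v \<in> V. odd (degree E v)} \<subseteq> {r}" using assms(2) by blast
  moreover have "{v \<in> V. odd (degree E v)} \<noteq> {r}"
    using even_card_odd_degree_vertices[OF assms(1)] by (metis card_1_singleton_iff odd_one One_nat_def)
  ultimately have "{v \<in> V. odd (degree E v)} = {}" by blast
  then show ?thesis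
    using degree_eq_0[OF assms(1)] unfolding even_degrees_def by fastforce
qed

abbreviation adjacency :: "'a set set \<Rightarrow> 'a rel" where
  "adjacency E \<equiv> {(x, y). {x, y} \<in> E}"

lemma odd_degree_reaches_odd_degree:
  assumes E: "simple_graph V E" and u: "odd (degree E u)"
  obtains w where "w \<noteq> u" "odd (degree E w)" "(u, w) \<in> (adjacency E)\<^sup>*"
proof -
  define K where "K = {w \<in> V. (u, w) \<in> (adjacency E)\<^sup>*}"
  define F where "F = {e \<in> E. e \<subseteq> K}"
  have edge_subset: "e \<subseteq> K" if e: "e \<in> E" "w \<in> e" "w \<in> K" for e w
  proof -
    obtain x where x: "e = {w, x}" using simple_graph_incident_edgeE[OF E e(1,2)] .
    then have "x \<in> V" using E e(1) unfolding simple_graph_def by blast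
    moreover have "(u, x) \<in> (adjacency E)\<^sup>*"
      using e x rtrancl_into_rtrancl[of u w "adjacency E" x] unfolding K_def by simp
    ultimately show ?thesis using e(3) x unfolding K_def by simp
  qed
  have degree_F: "degree F w = degree E w" if "w \<in> K" for w
    unfolding degree_def F_def using edge_subset that by (metis (no_types, lifting) mem_Collect_eq)
  have "simple_graph K F"
    using E unfolding simple_graph_def K_def F_def by auto
  then have "even (card {w \<in> K. odd (degree F w)})"
    by (rule even_card_odd_degree_vertices)
  moreover have "{w \<in> K. odd (degree F w)} = {w \<in> K. odd (degree E w)}"
    using degree_F by auto
  ultimately have "{w \<in> K. odd (degree E w)} \<noteq> {u}" by force
  moreover have "u \<in> K" using degree_eq_0[OF E, of u] u unfolding K_def by fastforce
  then have "u \<in> {w \<in> K. odd (degree E w)}" using u by simp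
  ultimately show thesis using that unfolding K_def by blast
qed

lemma cycles_mono: "A \<subseteq> B \<Longrightarrow> cycles A \<subseteq> cycles B"
  unfolding cycles_def by blast

lemma cycle_subset: "C \<in> cycles E \<Longrightarrow> C \<subseteq> E"
  unfolding cycles_def by blast

lemma ex_cycle_if_reachable:
  assumes uv: "{u, v} \<in> A" "u \<noteq> v" and reach: "(u, v) \<in> (adjacency (A - {{u, v}}))\<^sup>*"
  obtains C where "C \<in> cycles A" "{u, v} \<in> C"
proof -
  let ?adj = "\<lambda>x y. {x, y} \<in> A - {{u, v}}"
  have "?adj\<^sup>*\<^sup>* u v" using reach by (simp add: rtranclp_rtrancl_eq)
  then obtain xs where path: "rtrancl_path ?adj u xs v" and dist: "distinct (u # xs)"
    by (metis rtranclp_eq_rtrancl_path rtrancl_path_distinct)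
  have "xs \<noteq> []" using path uv(2) by (metis rtrancl_path.cases list.distinct(1))
  then have last: "last xs = v" using path by (metis rtrancl_path_last)
  have "length xs \<noteq> 1"
  proof
    assume "length xs = 1"
    then have "xs = [v]" using last by (auto simp: length_Suc_conv)
    then show False using rtrancl_path_nth[OF path, of 0] by simp
  qed
  then have len: "3 \<le> length (u # xs)"
    using \<open>xs \<noteq> []\<close> by (cases xs rule: list.exhaust) (auto simp: Suc_le_eq)
  let ?e = "\<lambda>i. {(u # xs) ! i, (u # xs) ! (Suc i mod length (u # xs))}"
  have closing: "?e (length xs) = {u, v}"
    using last \<open>xs \<noteq> []\<close> by (auto simp: last_conv_nth nth_Cons')
  have "?e i \<in> A" if "i < length (u # xs)" for i
  proof (cases "i = length xs")
    case True
    then show ?thesis using closing uv(1) by simp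
  next
    case False
    then show ?thesis using that rtrancl_path_nth[OF path, of i] by simp
  qed
  then have "cycle_edges (u # xs) \<in> cycles A"
    using dist len unfolding cycles_def cycle_edges_def by blast
  moreover have "{u, v} \<in> cycle_edges (u # xs)"
    unfolding cycle_edges_def using closing by force
  ultimately show thesis by (rule that)
qed

lemma even_degrees_edge_in_cycle:
  assumes graph: "simple_graph V A" and even: "even_degrees A" and f: "f \<in> A"
  obtains C where "C \<in> cycles A" "f \<in> C"
proof -
  obtain u v where uv: "f = {u, v}" "u \<noteq> v" using simple_graph_edgeE[OF graph f] .
  have fin: "finite A" using simple_graph_finite_edges[OF graph] .
  have odd_iff: "odd (degree (A - {f}) w) \<longleftrightarrow> w = u \<or> w = v" for w
  proof -
    have "{e \<in> {f}. w \<in> e} = (if w \<in> f then {f} else {})" by auto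
    moreover have "sym_diff A {f} = A - {f}" using f by blast
    moreover have "even (degree A w)" using even unfolding even_degrees_def by blast
    ultimately show ?thesis
      using odd_degree_sym_diff_iff[of A "{f}" w] fin uv(1) by (simp add: degree_def)
  qed
  obtain w where "w \<noteq> u" "odd (degree (A - {f}) w)" "(u, w) \<in> (adjacency (A - {f}))\<^sup>*"
  proof (rule odd_degree_reaches_odd_degree)
    show "simple_graph V (A - {f})" using graph by (rule simple_graph_subset) blast
    show "odd (degree (A - {f}) u)" using odd_iff by simp
  qed
  then have "(u, v) \<in> (adjacency (A - {{u, v}}))\<^sup>*" using odd_iff uv(1) by blast
  then show thesis using ex_cycle_if_reachable[of u v A] f uv that by blast
qed

lemma Suc_mod_eq_iff:
  assumes "i < n" "j < n"
  shows "Suc i mod n = j \<longleftrightarrow> i = (if j = 0 then n - 1 else j - 1)"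
  using assms by (auto simp: mod_Suc)

lemma degree_cycle_edges:
  assumes "distinct xs" "3 \<le> length xs" "v \<in> set xs"
  shows "degree (cycle_edges xs) v = 2"
proof -
  let ?n = "length xs"
  let ?e = "\<lambda>i. {xs ! i, xs ! (Suc i mod ?n)}"
  obtain j where j: "j < ?n" "v = xs ! j" using assms(3) by (metis in_set_conv_nth)
  define p where "p = (if j = 0 then ?n - 1 else j - 1)"
  have p: "p < ?n" "Suc p mod ?n = j" using j(1) Suc_mod_eq_iff[of p ?n j] by (auto simp: p_def)
  have Suc_mod: "Suc i mod ?n < ?n" for i using j(1) by (intro mod_less_divisor) linarith
  have nth_eq: "xs ! a = xs ! b \<longleftrightarrow> a = b" if "a < ?n" "b < ?n" for a b
    using nth_eq_iff_index_eq[OF assms(1) that] .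
  have "v \<in> ?e i \<longleftrightarrow> i = j \<or> i = p" if "i < ?n" for i
    using that j nth_eq Suc_mod Suc_mod_eq_iff[OF that j(1)] by (auto simp: p_def)
  then have "{e \<in> cycle_edges xs. v \<in> e} = {?e j, ?e p}"
    unfolding cycle_edges_def using j(1) p(1) by blast
  moreover have "?e j \<noteq> ?e p"
  proof
    assume "?e j = ?e p"
    then have "xs ! (Suc j mod ?n) = xs ! p" unfolding p(2) by (metis doubleton_eq_iff)
    then have "Suc j mod ?n = p" using nth_eq[OF Suc_mod p(1)] by simp
    then show False
      using j(1) assms(2) by (cases "Suc j = ?n") (auto simp: p_def split: if_splits)
  qed
  ultimately show ?thesis unfolding degree_def by simp
qed

lemma degree_cycle:
  assumes "C \<in> cycles E"
  shows "degree C v \<in> {0, 2}"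
proof -
  obtain xs where xs: "3 \<le> length xs" "distinct xs" "C = cycle_edges xs"
    using assms unfolding cycles_def by blast
  have "e \<subseteq> set xs" if "e \<in> C" for e
  proof -
    have "Suc i mod length xs < length xs" for i
      using xs(1) by (intro mod_less_divisor) linarith
    then show ?thesis using that nth_mem unfolding xs(3) cycle_edges_def by auto
  qed
  then have "degree C v = 0" if "v \<notin> set xs"
    using that by (intro degree_eq_0_if_not_incident) blast
  then show ?thesis using degree_cycle_edges[OF xs(2,1)] xs(3) by blast
qed

lemma cycle_even_degrees: "C \<in> cycles E \<Longrightarrow> even_degrees C"
  unfolding even_degrees_def using degree_cycle by (metis dvd_refl empty_iff even_zero insert_iff)

lemma cycle_nonempty: "C \<in> cycles E \<Longrightarrow> C \<noteq> {}"
  unfolding cycles_def cycle_edges_def by fastforce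

lemma even_degrees_is_cycle_if_indecomposable:
  assumes "simple_graph V A" "even_degrees A" "A \<noteq> {}"
    and "\<And>B. B \<subseteq> A \<Longrightarrow> even_degrees B \<Longrightarrow> B \<noteq> {} \<Longrightarrow> B = A"
  shows "A \<in> cycles A"
proof -
  obtain f where "f \<in> A" using assms(3) by blast
  then obtain C where C: "C \<in> cycles A"
    using even_degrees_edge_in_cycle[OF assms(1,2)] by blast
  then have "C = A" using assms(4) cycle_subset cycle_even_degrees cycle_nonempty by metis
  then show ?thesis using C by simp
qed

lemma even_degrees_card_ge_3:
  assumes "simple_graph V A" "even_degrees A" "A \<noteq> {}"
  shows "3 \<le> card A"
proof -
  obtain e where e: "e \<in> A" using assms(3) by blast
  then obtain u v where uv: "e = {u, v}" "u \<noteq> v" using simple_graph_edgeE[OF assms(1)] by metis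
  obtain e' where e': "e' \<in> A" "e' \<noteq> e" "u \<in> e'"
    using even_degrees_ex_other_edge[OF assms(2) e, of u] uv by auto
  then obtain w where w: "e' = {u, w}" "u \<noteq> w" using simple_graph_incident_edgeE[OF assms(1)] by metis
  obtain e'' where e'': "e'' \<in> A" "e'' \<noteq> e'" "w \<in> e''"
    using even_degrees_ex_other_edge[OF assms(2) e'(1), of w] w by auto
  have "e'' \<noteq> e" using e'' w uv e' by auto
  then have "card {e, e', e''} = 3" using e' e'' by auto
  moreover have "{e, e', e''} \<subseteq> A" using e e' e'' by auto
  ultimately show ?thesis
    using card_mono[OF simple_graph_finite_edges[OF assms(1)]] by metis
qed

lemma small_even_degrees_is_cycle:
  assumes graph: "simple_graph V A" and even: "even_degrees A" and "A \<noteq> {}" and small: "card A \<le> 5"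
  shows "A \<in> cycles A"
proof (rule even_degrees_is_cycle_if_indecomposable[OF graph even \<open>A \<noteq> {}\<close>])
  fix B assume B: "B \<subseteq> A" "even_degrees B" "B \<noteq> {}"
  have fin: "finite A" using simple_graph_finite_edges[OF graph] .
  show "B = A"
  proof (rule ccontr)
    assume "B \<noteq> A"
    then have "A - B \<noteq> {}" using B(1) by blast
    then have "3 \<le> card (A - B)"
      using even_degrees_card_ge_3 simple_graph_subset[OF graph] even_degrees_Diff[OF fin even B(1,2)]
      by blast
    moreover have "3 \<le> card B"
      using even_degrees_card_ge_3[OF simple_graph_subset[OF graph B(1)] B(2,3)] .
    moreover have "card A = card B + card (A - B)"
      using card_Int_Diff[OF fin, of B] B(1) by (simp add: Int_absorb1)
    ultimately show False using small by linarith
  qed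
qed

section \<open>Forests\<close>

abbreviation forest :: "'a set set \<Rightarrow> bool" where
  "forest T \<equiv> cycles T = {}"

lemma forest_even_degrees_empty:
  assumes "forest T" "simple_graph V T" "A \<subseteq> T" "even_degrees A"
  shows "A = {}"
proof (rule ccontr)
  assume "A \<noteq> {}"
  then obtain C where "C \<in> cycles A"
    using even_degrees_edge_in_cycle[OF simple_graph_subset[OF assms(2,3)] assms(4)] by blast
  then show False using assms(1) cycles_mono[OF assms(3)] by blast
qed

text \<open>
  A subset of a forest is determined by the vertices at which its degree is odd, and the parity at
  one vertex \<open>r\<close> is determined by the others.
\<close>

lemma card_forest_less:
  assumes forest: "forest T" and graph: "simple_graph V T" and r: "r \<in> V"
  shows "card T < card V"
proof -
  let ?odd = "\<lambda>A. {v \<in> V - {r}. odd (degree A v)}"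
  have finite_V: "finite V" using graph unfolding simple_graph_def by blast
  have finite_T: "finite T" using simple_graph_finite_edges[OF graph] .
  have "inj_on ?odd (Pow T)"
  proof (rule inj_onI)
    fix A B assume A: "A \<in> Pow T" and B: "B \<in> Pow T" and eq: "?odd A = ?odd B"
    have fin: "finite A" "finite B" using A B finite_T finite_subset by auto
    have "even (degree (sym_diff A B) v)" if "v \<in> V - {r}" for v
      using eq that odd_degree_sym_diff_iff[OF fin, of v] by blast
    moreover have "sym_diff A B \<subseteq> T" using A B by blast
    ultimately have "sym_diff A B = {}"
      using even_degrees_if_even_off_vertex forest_even_degrees_empty[OF forest graph] simple_graph_subset[OF graph]
      by metis
    then show "A = B" by blast
  qed
  moreover have "?odd ` Pow T \<subseteq> Pow (V - {r})" by blast
  ultimately have "card (Pow T) \<le> card (Pow (V - {r}))" using finite_V by (intro card_inj_on_le) auto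
  then have "card T \<le> card (V - {r})" using finite_V finite_T by (simp add: card_Pow)
  also have "\<dots> < card V" using finite_V r by (rule card_Diff1_less)
  finally show ?thesis .
qed

section \<open>Fundamental cycles\<close>

locale maximal_forest =
  fixes V :: "'a set" and E T :: "'a set set"
  assumes graph: "simple_graph V E"
    and forest_subset: "T \<subseteq> E"
    and forest: "forest T"
    and maximal: "f \<in> E - T \<Longrightarrow> \<not> forest (insert f T)"

lemma ex_maximal_forest:
  assumes "simple_graph V E"
  obtains T where "maximal_forest V E T"
proof -
  let ?F = "{T \<in> Pow E. forest T}"
  have "finite (Pow E)" using simple_graph_finite_edges[OF assms] by simp
  then have "finite ?F" by (rule rev_finite_subset) blast
  moreover have "forest ({} :: 'a set set)"
    using cycle_subset cycle_nonempty by (metis all_not_in_conv subset_empty)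
  then have "?F \<noteq> {}" by auto
  ultimately obtain T where T: "T \<in> ?F" "\<forall>S\<in>?F. T \<subseteq> S \<longrightarrow> T = S"
    using finite_has_maximal[of ?F] by meson
  have "\<not> forest (insert f T)" if f: "f \<in> E - T" for f
  proof
    assume "forest (insert f T)"
    then have "insert f T \<in> ?F" using f T(1) by simp
    then have "T = insert f T" using T(2) by (meson subset_insertI)
    then show False using f by auto
  qed
  then have "maximal_forest V E T" using assms T(1) by unfold_locales auto
  then show thesis by (rule that)
qed

context maximal_forest
begin

abbreviation chords :: "'a set set" where
  "chords \<equiv> E - T"

definition fund_cycle :: "'a set \<Rightarrow> 'a set set" where
  "fund_cycle f = (SOME C. C \<in> cycles (insert f T))"

definition tree_path :: "'a set \<Rightarrow> 'a set set" where
  "tree_path f = fund_cycle f \<inter> T"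

definition cycle_chords :: "'a set set set" where
  "cycle_chords = (\<lambda>C. C - T) ` cycles E"

lemma finite_edges: "finite E"
  using graph by (rule simple_graph_finite_edges)

lemma finite_chords: "finite chords"
  using finite_edges by simp

lemma finite_cycles: "finite (cycles E)"
  by (rule finite_subset[of _ "Pow E"]) (auto simp: cycles_def finite_edges)

lemma
  assumes "f \<in> chords"
  shows fund_cycle_in_cycles: "fund_cycle f \<in> cycles E"
    and fund_cycle_Diff_forest: "fund_cycle f - T = {f}"
proof -
  have C: "fund_cycle f \<in> cycles (insert f T)"
    unfolding fund_cycle_def using maximal[OF assms] by (simp add: some_in_eq)
  have "insert f T \<subseteq> E" using assms forest_subset by simp
  then show "fund_cycle f \<in> cycles E" using C cycles_mono by (meson subsetD)
  have "fund_cycle f \<notin> cycles T" using forest by simp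
  then have "\<not> fund_cycle f \<subseteq> T" using C unfolding cycles_def by blast
  then show "fund_cycle f - T = {f}" using cycle_subset[OF C] by blast
qed

lemma fund_cycle_subset: "f \<in> chords \<Longrightarrow> fund_cycle f \<subseteq> E"
  and even_degrees_fund_cycle: "f \<in> chords \<Longrightarrow> even_degrees (fund_cycle f)"
  using fund_cycle_in_cycles cycle_subset cycle_even_degrees by blast+

lemma fund_cycle_eq_insert: "f \<in> chords \<Longrightarrow> fund_cycle f = insert f (tree_path f)"
  using fund_cycle_Diff_forest unfolding tree_path_def by blast

lemma tree_path_subset: "tree_path f \<subseteq> T"
  unfolding tree_path_def by blast

lemma finite_tree_path: "finite (tree_path f)"
  using tree_path_subset forest_subset finite_edges by (meson finite_subset)

lemma even_degrees_sym_diff_edges: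
  assumes "A \<subseteq> E" "B \<subseteq> E" "even_degrees A" "even_degrees B"
  shows "even_degrees (sym_diff A B)"
  using assms finite_edges by (meson even_degrees_sym_diff finite_subset)

lemma even_degrees_empty_if_no_chords:
  assumes "A \<subseteq> T" "even_degrees A"
  shows "A = {}"
  using forest simple_graph_subset[OF graph forest_subset] assms by (rule forest_even_degrees_empty)

lemma even_degrees_eqI:
  assumes "A \<subseteq> E" "B \<subseteq> E" "even_degrees A" "even_degrees B" "A - T = B - T"
  shows "A = B"
proof -
  have "sym_diff A B \<subseteq> T" using assms(5) by blast
  then have "sym_diff A B = {}"
    using even_degrees_empty_if_no_chords even_degrees_sym_diff_edges[OF assms(1-4)] by blast
  then show ?thesis by blast
qed

lemma card_tree_path_ge_2:
  assumes "f \<in> chords"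
  shows "2 \<le> card (tree_path f)"
proof -
  have "3 \<le> card (fund_cycle f)"
    using even_degrees_card_ge_3 simple_graph_subset[OF graph fund_cycle_subset]
      even_degrees_fund_cycle fund_cycle_eq_insert assms by (metis insert_not_empty)
  moreover have "f \<notin> tree_path f" using assms tree_path_subset by blast
  ultimately show ?thesis using fund_cycle_eq_insert[OF assms] finite_tree_path by simp
qed

lemma tree_path_nonempty: "f \<in> chords \<Longrightarrow> tree_path f \<noteq> {}"
  using card_tree_path_ge_2[of f] by auto

lemma tree_path_inject:
  assumes "f \<in> chords" "g \<in> chords" "tree_path f = tree_path g"
  shows "f = g"
proof (rule ccontr)
  assume neq: "f \<noteq> g"
  have sum_eq: "sym_diff (fund_cycle f) (fund_cycle g) = {f, g}"
    using neq assms fund_cycle_eq_insert tree_path_subset by blast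
  have "even_degrees {f, g}"
    using even_degrees_sym_diff_edges[OF fund_cycle_subset fund_cycle_subset]
      even_degrees_fund_cycle assms(1,2) unfolding sum_eq[symmetric] by blast
  then have "3 \<le> card {f, g}"
    using even_degrees_card_ge_3[OF simple_graph_subset[OF graph]] assms(1,2) by simp
  then show False using neq by simp
qed

text \<open>
  If \<open>A\<close> is the disjoint union of two nonempty even sets, one of them has exactly one chord, so it is
  a fundamental cycle.
\<close>

lemma even_degrees_is_cycle_if_no_fund_cycle:
  assumes subset: "A \<subseteq> E" and even: "even_degrees A" and "A \<noteq> {}"
    and few_chords: "card (A - T) \<le> 3"
    and no_fund: "\<And>f. f \<in> A - T \<Longrightarrow> \<not> fund_cycle f \<subset> A"
  shows "A \<in> cycles E"
proof -
  have fin: "finite A" using subset finite_edges finite_subset by blast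
  have card_chords_ne_1: "card (D - T) \<noteq> 1" if D: "D \<subset> A" "even_degrees D" for D
  proof
    assume "card (D - T) = 1"
    then obtain f where f: "D - T = {f}" by (rule card_1_singletonE)
    then have "f \<in> chords" using D(1) subset by blast
    then have "D = fund_cycle f"
      using even_degrees_eqI[of D "fund_cycle f"] D subset f fund_cycle_subset
        even_degrees_fund_cycle fund_cycle_Diff_forest by auto
    then show False using no_fund f D(1) by blast
  qed
  have "B = A" if B: "B \<subseteq> A" "even_degrees B" "B \<noteq> {}" for B
  proof (rule ccontr)
    assume neq: "B \<noteq> A"
    have rest: "even_degrees (A - B)" using even_degrees_Diff[OF fin even B(1,2)] .
    have "B - T \<noteq> {}" "A - B - T \<noteq> {}"
      using even_degrees_empty_if_no_chords B(2,3) rest neq B(1) by blast+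
    then have "card (B - T) \<noteq> 0" "card (A - B - T) \<noteq> 0"
      using fin finite_subset[OF B(1) fin] by simp_all
    moreover have "(A - T) \<inter> B = B - T" "A - T - B = A - B - T" using B(1) by blast+
    then have "card (A - T) = card (B - T) + card (A - B - T)"
      using card_Int_Diff[of "A - T" B] fin by simp
    ultimately have "card (B - T) = 1 \<or> card (A - B - T) = 1" using few_chords by linarith
    moreover have "B \<subset> A" "A - B \<subset> A" using B(1,3) neq by blast+
    ultimately show False using card_chords_ne_1 B(2) rest by blast
  qed
  then have "A \<in> cycles A"
    using even_degrees_is_cycle_if_indecomposable[OF simple_graph_subset[OF graph subset] even \<open>A \<noteq> {}\<close>]
    by blast
  then show ?thesis using cycles_mono[OF subset] by blast
qed

lemma sym_diff_fund_cycle: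
  assumes "A \<subseteq> E" "even_degrees A" "f \<in> chords" "f \<notin> A"
  shows "sym_diff A (fund_cycle f) \<subseteq> E" "even_degrees (sym_diff A (fund_cycle f))"
    "sym_diff A (fund_cycle f) - T = insert f (A - T)"
proof -
  show "even_degrees (sym_diff A (fund_cycle f))"
    using even_degrees_sym_diff_edges[OF assms(1) fund_cycle_subset assms(2) even_degrees_fund_cycle]
      assms(3) by blast
  show "sym_diff A (fund_cycle f) \<subseteq> E" using assms(1) fund_cycle_subset[OF assms(3)] by blast
  show "sym_diff A (fund_cycle f) - T = insert f (A - T)"
    using fund_cycle_Diff_forest[OF assms(3)] assms(4) by auto
qed

lemma sym_diff_two_fund_cycles:
  assumes "f \<in> chords" "g \<in> chords" "f \<noteq> g"
  shows "sym_diff (fund_cycle f) (fund_cycle g) \<subseteq> E"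
    "even_degrees (sym_diff (fund_cycle f) (fund_cycle g))"
    "sym_diff (fund_cycle f) (fund_cycle g) - T = {f, g}"
proof -
  have "g \<notin> fund_cycle f" using fund_cycle_Diff_forest assms by blast
  note pair_sum = sym_diff_fund_cycle[OF fund_cycle_subset even_degrees_fund_cycle, OF assms(1,1,2) this]
  show "sym_diff (fund_cycle f) (fund_cycle g) \<subseteq> E"
    "even_degrees (sym_diff (fund_cycle f) (fund_cycle g))"
    using pair_sum(1,2) .
  show "sym_diff (fund_cycle f) (fund_cycle g) - T = {f, g}"
    using pair_sum(3) fund_cycle_Diff_forest[OF assms(1)] by (simp add: insert_commute)
qed

lemma sym_diff_three_fund_cycles:
  fixes f g h :: "'a set"
  defines "A \<equiv> sym_diff (sym_diff (fund_cycle f) (fund_cycle g)) (fund_cycle h)"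
  assumes chords: "f \<in> chords" "g \<in> chords" "h \<in> chords"
    and distinct: "f \<noteq> g" "f \<noteq> h" "g \<noteq> h"
  shows "A \<subseteq> E" "even_degrees A" "A - T = {f, g, h}"
proof -
  let ?B = "sym_diff (fund_cycle f) (fund_cycle g)"
  note pair_sum = sym_diff_two_fund_cycles[OF chords(1,2) distinct(1)]
  have "h \<notin> ?B - T" unfolding pair_sum(3) using distinct by simp
  then have "h \<notin> ?B" using chords(3) by blast
  note triple_sum = sym_diff_fund_cycle[OF pair_sum(1,2) chords(3) this]
  show "A \<subseteq> E" "even_degrees A" "A - T = {f, g, h}"
    using triple_sum unfolding pair_sum(3) A_def by (simp_all add: insert_commute)
qed

lemma cycle_chordsI: "C \<in> cycles E \<Longrightarrow> C - T \<in> cycle_chords"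
  unfolding cycle_chords_def by (rule imageI)

lemma singleton_in_cycle_chords: "f \<in> chords \<Longrightarrow> {f} \<in> cycle_chords"
  using cycle_chordsI fund_cycle_in_cycles fund_cycle_Diff_forest by metis

lemma pair_in_cycle_chords:
  assumes "f \<in> chords" "g \<in> chords" and meet: "tree_path f \<inter> tree_path g \<noteq> {}"
  shows "{f, g} \<in> cycle_chords"
proof (cases "f = g")
  case True
  then show ?thesis using singleton_in_cycle_chords[OF assms(1)] by simp
next
  case False
  let ?A = "sym_diff (fund_cycle f) (fund_cycle g)"
  note pair_sum = sym_diff_two_fund_cycles[OF assms(1,2) False]
  have "?A \<in> cycles E"
  proof (rule even_degrees_is_cycle_if_no_fund_cycle[OF pair_sum(1,2)])
    show "?A \<noteq> {}" using pair_sum(3) by blast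
    show "card (?A - T) \<le> 3" unfolding pair_sum(3) by (simp add: card_insert_if)
    show "\<not> fund_cycle x \<subset> ?A" if "x \<in> ?A - T" for x
      using that meet unfolding pair_sum(3) tree_path_def by blast
  qed
  then show ?thesis unfolding pair_sum(3)[symmetric] by (rule cycle_chordsI)
qed

lemma triple_in_cycle_chords_if_path:
  assumes chords: "f \<in> chords" "g \<in> chords" "h \<in> chords"
    and distinct: "f \<noteq> g" "f \<noteq> h" "g \<noteq> h"
    and meet: "tree_path f \<inter> tree_path g \<noteq> {}" "tree_path f \<inter> tree_path h \<noteq> {}"
    and disj: "tree_path g \<inter> tree_path h = {}"
  shows "{f, g, h} \<in> cycle_chords"
proof -
  let ?A = "sym_diff (sym_diff (fund_cycle f) (fund_cycle g)) (fund_cycle h)"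
  note triple_sum = sym_diff_three_fund_cycles[OF chords distinct]
  have "?A \<in> cycles E"
  proof (rule even_degrees_is_cycle_if_no_fund_cycle[OF triple_sum(1,2)])
    show "?A \<noteq> {}" using triple_sum(3) by blast
    show "card (?A - T) \<le> 3" unfolding triple_sum(3) by (simp add: card_insert_if)
    show "\<not> fund_cycle x \<subset> ?A" if "x \<in> ?A - T" for x
      using that meet disj unfolding triple_sum(3) tree_path_def by blast
  qed
  then show ?thesis unfolding triple_sum(3)[symmetric] by (rule cycle_chordsI)
qed

lemma triple_in_cycle_chords_if_small:
  assumes chords: "f \<in> chords" "g \<in> chords" "h \<in> chords"
    and distinct: "f \<noteq> g" "f \<noteq> h" "g \<noteq> h"
    and small: "card (tree_path f \<union> tree_path g \<union> tree_path h) \<le> 3"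
  shows "{f, g, h} \<in> cycle_chords"
proof -
  let ?A = "sym_diff (sym_diff (fund_cycle f) (fund_cycle g)) (fund_cycle h)"
  let ?P = "sym_diff (sym_diff (tree_path f) (tree_path g)) (tree_path h)"
  note triple_sum = sym_diff_three_fund_cycles[OF chords distinct]
  have "card ?P \<le> 2"
    using chords distinct small tree_path_inject finite_tree_path card_tree_path_ge_2
    by (intro card_sym_diff_three_le_2) blast+
  moreover have "?A \<inter> T = ?P" unfolding tree_path_def by blast
  moreover have "card ?A = card (?A \<inter> T) + card (?A - T)"
    using triple_sum(1) finite_edges finite_subset by (intro card_Int_Diff) blast
  ultimately have "card ?A \<le> 5" unfolding triple_sum(3) using distinct by simp
  moreover have "?A \<noteq> {}" using triple_sum(3) by blast
  ultimately have "?A \<in> cycles ?A"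
    using small_even_degrees_is_cycle[OF simple_graph_subset[OF graph triple_sum(1)] triple_sum(2)] by blast
  then have "?A \<in> cycles E" using cycles_mono[OF triple_sum(1)] by blast
  then show ?thesis unfolding triple_sum(3)[symmetric] by (rule cycle_chordsI)
qed

end

section \<open>The upper bound\<close>

locale few_cycles_forest = maximal_forest +
  fixes k :: nat
  assumes card_cycles_le: "f \<in> E \<Longrightarrow> card {C \<in> cycles E. f \<in> C} \<le> k"
    and k_le_3: "k \<le> 3"
begin

lemma card_cycle_chords_le:
  assumes "f \<in> chords" "\<X> \<subseteq> cycle_chords" "\<And>X. X \<in> \<X> \<Longrightarrow> f \<in> X"
  shows "card \<X> \<le> k"
proof -
  let ?C = "{C \<in> cycles E. f \<in> C}"
  have fin: "finite ?C" using finite_cycles by simp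
  have "\<X> \<subseteq> (\<lambda>C. C - T) ` ?C"
    using assms(2,3) unfolding cycle_chords_def by blast
  then have "card \<X> \<le> card ?C" using fin surj_card_le by blast
  also have "\<dots> \<le> k" using card_cycles_le assms(1) by blast
  finally show ?thesis .
qed

definition overlap :: "'a set rel" where
  "overlap = {(f, g) \<in> chords \<times> chords. tree_path f \<inter> tree_path g \<noteq> {}}"

lemma triple_not_in_cycle_chords:
  assumes fg: "(f, g) \<in> overlap" and fh: "(f, h) \<in> overlap"
    and distinct: "f \<noteq> g" "f \<noteq> h" "g \<noteq> h"
  shows "{f, g, h} \<notin> cycle_chords"
proof
  assume fgh: "{f, g, h} \<in> cycle_chords"
  let ?X = "{{f}, {f, g}, {f, h}, {f, g, h}}"
  have f: "f \<in> chords" using fg unfolding overlap_def by blast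
  have "?X \<subseteq> cycle_chords"
    using singleton_in_cycle_chords[OF f] pair_in_cycle_chords fg fh fgh
    unfolding overlap_def by blast
  then have "card ?X \<le> k" by (rule card_cycle_chords_le[OF f]) blast
  moreover have "card ?X = 4" using distinct by (auto simp: card_insert_if doubleton_eq_iff)
  ultimately show False using k_le_3 by linarith
qed

lemma equiv_overlap: "equiv chords overlap"
proof (rule equivI)
  show "overlap \<subseteq> chords \<times> chords" unfolding overlap_def by blast
  show "refl_on chords overlap"
    using tree_path_nonempty by (auto simp: refl_on_def overlap_def)
  show "sym overlap" by (auto simp: sym_def overlap_def)
  then have overlap_sym: "(g, f) \<in> overlap" if "(f, g) \<in> overlap" for f g
    using that by (rule symD)
  show "trans overlap"
  proof (rule transI)
    fix f g h assume fg: "(f, g) \<in> overlap" and gh: "(g, h) \<in> overlap"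
    show "(f, h) \<in> overlap"
    proof (cases "f = g \<or> g = h \<or> f = h")
      case True
      then show ?thesis using fg gh tree_path_nonempty by (auto simp: overlap_def)
    next
      case False
      then have "{g, f, h} \<notin> cycle_chords"
        using triple_not_in_cycle_chords[OF overlap_sym[OF fg] gh] by blast
      then have "tree_path f \<inter> tree_path h \<noteq> {}"
        using triple_in_cycle_chords_if_path[of g f h] fg gh False unfolding overlap_def by blast
      then show ?thesis using fg gh unfolding overlap_def by blast
    qed
  qed
qed

lemma
  assumes "S \<in> chords // overlap"
  shows overlap_class_subset: "S \<subseteq> chords"
    and overlap_class_nonempty: "S \<noteq> {}"
    and overlap_class_related: "f \<in> S \<Longrightarrow> g \<in> S \<Longrightarrow> (f, g) \<in> overlap"
  using in_quotient_imp_subset[OF equiv_overlap assms]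
    in_quotient_imp_non_empty[OF equiv_overlap assms]
    quotient_eq_iff[OF equiv_overlap assms assms] by simp_all

lemma finite_overlap_class: "S \<in> chords // overlap \<Longrightarrow> finite S"
  using overlap_class_subset finite_chords finite_subset by blast

lemma card_overlap_class_le:
  assumes S: "S \<in> chords // overlap"
  shows "card S \<le> k"
proof -
  obtain f where f: "f \<in> S" using overlap_class_nonempty[OF S] by blast
  have "inj_on (\<lambda>g. {f, g}) S" by (auto simp: inj_on_def doubleton_eq_iff)
  then have "card S = card ((\<lambda>g. {f, g}) ` S)" by (rule card_image[symmetric])
  also have "\<dots> \<le> k"
  proof (rule card_cycle_chords_le)
    show "f \<in> chords" using f overlap_class_subset[OF S] by blast
    show "(\<lambda>g. {f, g}) ` S \<subseteq> cycle_chords"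
      using overlap_class_related[OF S f] pair_in_cycle_chords unfolding overlap_def by auto
  qed blast
  finally show ?thesis .
qed

definition covered :: "'a set set \<Rightarrow> 'a set set" where
  "covered S = (\<Union>f\<in>S. tree_path f)"

lemma finite_covered: "S \<in> chords // overlap \<Longrightarrow> finite (covered S)"
  unfolding covered_def using finite_overlap_class finite_tree_path by blast

lemma tree_path_subset_covered: "f \<in> S \<Longrightarrow> tree_path f \<subseteq> covered S"
  unfolding covered_def by blast

lemma card_covered_ge_2:
  assumes S: "S \<in> chords // overlap"
  shows "2 \<le> card (covered S)"
proof -
  obtain f where f: "f \<in> S" using overlap_class_nonempty[OF S] by blast
  then have "2 \<le> card (tree_path f)" using overlap_class_subset[OF S] card_tree_path_ge_2 by blast
  also have "\<dots> \<le> card (covered S)"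
    using finite_covered[OF S] tree_path_subset_covered[OF f] by (rule card_mono)
  finally show ?thesis .
qed

lemma card_covered_ge_3:
  assumes S: "S \<in> chords // overlap" and fg: "f \<in> S" "g \<in> S" "f \<noteq> g"
  shows "3 \<le> card (covered S)"
proof (rule ccontr)
  assume "\<not> ?thesis"
  then have "card (covered S) \<le> card (tree_path x)" if "x \<in> S" for x
    using card_tree_path_ge_2[of x] overlap_class_subset[OF S] that by fastforce
  then have "tree_path x = covered S" if "x \<in> S" for x
    using card_seteq[OF finite_covered[OF S] tree_path_subset_covered] that by blast
  then show False using fg tree_path_inject overlap_class_subset[OF S] by (metis subsetD)
qed

lemma card_overlap_class_less_covered:
  assumes S: "S \<in> chords // overlap"
  shows "card S < card (covered S)"
proof -
  have "card S \<noteq> 0" using overlap_class_nonempty[OF S] finite_overlap_class[OF S] by simp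
  then consider "card S = 1" | "card S = 2" | "card S = 3"
    using card_overlap_class_le[OF S] k_le_3 by linarith
  then show ?thesis
  proof cases
    assume "card S = 1"
    then show ?thesis using card_covered_ge_2[OF S] by simp
  next
    assume card_2: "card S = 2"
    then obtain f g where "S = {f, g}" "f \<noteq> g" by (meson card_2_iff)
    then show ?thesis using card_2 card_covered_ge_3[OF S, of f g] by simp
  next
    assume card_3: "card S = 3"
    then obtain f g h where S_eq: "S = {f, g, h}" and distinct: "f \<noteq> g" "f \<noteq> h" "g \<noteq> h"
      by (metis card_3_iff)
    have "{f, g, h} \<notin> cycle_chords"
      using overlap_class_related[OF S] S_eq distinct by (intro triple_not_in_cycle_chords) simp_all
    moreover have "f \<in> chords" "g \<in> chords" "h \<in> chords"
      using overlap_class_subset[OF S] S_eq by blast+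
    ultimately have "\<not> card (tree_path f \<union> tree_path g \<union> tree_path h) \<le> 3"
      using triple_in_cycle_chords_if_small distinct by blast
    moreover have "covered S = tree_path f \<union> tree_path g \<union> tree_path h"
      unfolding covered_def S_eq by blast
    ultimately show ?thesis using card_3 by simp
  qed
qed

lemma finite_overlap_classes: "finite (chords // overlap)"
  using finite_chords equiv_type[OF equiv_overlap] by (rule finite_quotient)

lemma card_chords_eq_sum: "card chords = (\<Sum>S\<in>chords // overlap. card S)"
proof -
  have "card (\<Union>(chords // overlap)) = sum card (chords // overlap)"
    using quotient_disj[OF equiv_overlap] finite_overlap_class
    by (intro card_Union_disjoint) (auto simp: pairwise_def disjnt_def)
  then show ?thesis by (simp add: Union_quotient[OF equiv_overlap])
qed

lemma sum_card_covered_le: "(\<Sum>S\<in>chords // overlap. card (covered S)) \<le> card T"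
proof -
  have "covered S \<inter> covered S' = {}"
    if S: "S \<in> chords // overlap" "S' \<in> chords // overlap" "S \<noteq> S'" for S S'
  proof -
    have "tree_path f \<inter> tree_path g = {}" if "f \<in> S" "g \<in> S'" for f g
    proof -
      have "(f, g) \<notin> overlap" using quotient_eqI[OF equiv_overlap S(1,2) that] S(3) by blast
      then show ?thesis using that overlap_class_subset S(1,2) unfolding overlap_def by blast
    qed
    then show ?thesis unfolding covered_def by blast
  qed
  then have "(\<Sum>S\<in>chords // overlap. card (covered S)) = card (\<Union>S\<in>chords // overlap. covered S)"
    using finite_overlap_classes finite_covered by (intro card_UN_disjoint[symmetric]) auto
  also have "\<dots> \<le> card T"
    using tree_path_subset finite_subset[OF forest_subset finite_edges]
    unfolding covered_def by (intro card_mono) blast+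
  finally show ?thesis .
qed

lemma card_chords_le: "(k + 1) * card chords \<le> k * card T"
proof -
  have "(k + 1) * card chords = (\<Sum>S\<in>chords // overlap. (k + 1) * card S)"
    by (simp only: card_chords_eq_sum sum_distrib_left)
  also have "\<dots> \<le> (\<Sum>S\<in>chords // overlap. k * card (covered S))"
  proof (rule sum_mono)
    fix S assume S: "S \<in> chords // overlap"
    have "(k + 1) * card S \<le> k * (card S + 1)" using card_overlap_class_le[OF S] by simp
    also have "\<dots> \<le> k * card (covered S)"
      using card_overlap_class_less_covered[OF S] by (intro mult_le_mono2) simp
    finally show "(k + 1) * card S \<le> k * card (covered S)" .
  qed
  also have "\<dots> = k * (\<Sum>S\<in>chords // overlap. card (covered S))" by (simp add: sum_distrib_left)
  also have "\<dots> \<le> k * card T" using sum_card_covered_le by (rule mult_le_mono2)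
  finally show ?thesis .
qed

end

theorem card_edges_le_if_few_cycles:
  assumes E: "simple_graph V E" and "V \<noteq> {}"
    and few: "\<And>e. e \<in> E \<Longrightarrow> card {C \<in> cycles E. e \<in> C} \<le> k" and "k \<le> 3"
  shows "(k + 1) * card E \<le> (2 * k + 1) * (card V - 1)"
proof -
  obtain r where r: "r \<in> V" using \<open>V \<noteq> {}\<close> by blast
  obtain T where "maximal_forest V E T" using ex_maximal_forest[OF E] .
  then interpret few_cycles_forest V E T k
    using few \<open>k \<le> 3\<close> by (simp add: few_cycles_forest_def few_cycles_forest_axioms_def)
  have "card E = card T + card chords"
    using card_Int_Diff[OF finite_edges, of T] forest_subset by (simp add: Int_absorb1)
  then have "(k + 1) * card E = (k + 1) * card T + (k + 1) * card chords"
    by (simp add: algebra_simps)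
  also have "\<dots> \<le> (2 * k + 1) * card T" using card_chords_le by (simp add: algebra_simps)
  also have "\<dots> \<le> (2 * k + 1) * (card V - 1)"
    using card_forest_less[OF forest simple_graph_subset[OF graph forest_subset] r]
    by (intro mult_le_mono2) simp
  finally show ?thesis .
qed

section \<open>Cones over star forests\<close>

locale star_forest_cone =
  fixes apex :: 'a and W L :: "'a set" and hub :: "'a \<Rightarrow> 'a"
  assumes finite_vertices: "finite W"
    and apex_notin: "apex \<notin> W"
    and leaf_vertex: "v \<in> L \<Longrightarrow> v \<in> W"
    and hub_nonleaf: "v \<in> L \<Longrightarrow> hub v \<in> W - L"
begin

definition spokes :: "'a set set" where
  "spokes = (\<lambda>v. {apex, v}) ` W"

definition star_edges :: "'a set set" where
  "star_edges = (\<lambda>v. {hub v, v}) ` L"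

definition cone :: "'a set set" where
  "cone = spokes \<union> star_edges"

lemma finite_leaves: "finite L"
  using finite_vertices leaf_vertex by (meson finite_subset subsetI)

lemma apex_neq_vertex: "v \<in> W \<Longrightarrow> apex \<noteq> v"
  using apex_notin by blast

lemma apex_neq_hub: "v \<in> L \<Longrightarrow> apex \<noteq> hub v"
  using apex_notin hub_nonleaf by blast

lemma apex_neq_leaf: "v \<in> L \<Longrightarrow> apex \<noteq> v"
  using apex_notin leaf_vertex by blast

lemma hub_neq_leaf: "v \<in> L \<Longrightarrow> w \<in> L \<Longrightarrow> hub v \<noteq> w"
  using hub_nonleaf by blast

lemma simple_graph_cone: "simple_graph (insert apex W) cone"
  unfolding simple_graph_def cone_def spokes_def star_edges_def
  using finite_vertices leaf_vertex hub_nonleaf apex_neq_vertex hub_neq_leaf by fastforce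

lemma connected_graph_cone: "connected_graph (insert apex W) cone"
  unfolding connected_graph_def
proof (intro conjI ballI)
  fix u v assume uv: "u \<in> insert apex W" "v \<in> insert apex W"
  have "(apex, x) \<in> (adjacency cone)\<^sup>* \<and> (x, apex) \<in> (adjacency cone)\<^sup>*" if "x \<in> insert apex W" for x
  proof (cases "x = apex")
    case False
    then have "{apex, x} \<in> cone" using that unfolding cone_def spokes_def by blast
    then have "(apex, x) \<in> adjacency cone" "(x, apex) \<in> adjacency cone"
      by (simp_all add: insert_commute)
    then show ?thesis by blast
  qed simp
  then show "(u, v) \<in> (adjacency cone)\<^sup>*" using uv by (meson rtrancl_trans)
qed simp

lemma card_cone: "card cone = card W + card L"
proof -
  have "card spokes = card W"
    unfolding spokes_def by (intro card_image) (auto simp: inj_on_def doubleton_eq_iff)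
  moreover have "card star_edges = card L"
    unfolding star_edges_def
    using hub_neq_leaf by (intro card_image inj_onI) (metis doubleton_eq_iff)
  moreover have "spokes \<inter> star_edges = {}"
    unfolding spokes_def star_edges_def
    using apex_neq_leaf apex_neq_hub by (auto simp: doubleton_eq_iff)
  ultimately show ?thesis
    unfolding cone_def spokes_def star_edges_def
    using finite_vertices finite_leaves by (simp add: card_Un_disjoint)
qed

lemma cone_edges_at_leaf:
  assumes "v \<in> L"
  shows "{e \<in> cone. v \<in> e} = {{apex, v}, {hub v, v}}"
  unfolding cone_def spokes_def star_edges_def
  using assms leaf_vertex[OF assms] apex_neq_leaf hub_neq_leaf by auto

lemma cone_edges_at_nonleaf:
  assumes "h \<in> W - L"
  shows "{e \<in> cone. h \<in> e} = insert {apex, h} ((\<lambda>v. {h, v}) ` {v \<in> L. hub v = h})"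
  unfolding cone_def spokes_def star_edges_def
  using assms apex_neq_vertex by auto

definition used_leaves :: "'a set set \<Rightarrow> 'a set" where
  "used_leaves A = {v \<in> L. {hub v, v} \<in> A}"

lemma finite_used_leaves: "finite (used_leaves A)"
  unfolding used_leaves_def using finite_leaves by simp

context
  fixes A :: "'a set set"
  assumes subset: "A \<subseteq> cone" and even: "even_degrees A"
begin

lemma even_degrees_leaf_spoke_iff:
  assumes "v \<in> L"
  shows "{apex, v} \<in> A \<longleftrightarrow> v \<in> used_leaves A"
proof -
  have edges: "{e \<in> A. v \<in> e} \<subseteq> {{apex, v}, {hub v, v}}"
    using subset cone_edges_at_leaf[OF assms] by blast
  have "\<exists>e'\<in>A. e' \<noteq> e \<and> v \<in> e'" if "e \<in> A" "v \<in> e" for e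
    using even_degrees_ex_other_edge[OF even that] by blast
  then show ?thesis
    using edges assms unfolding used_leaves_def by blast
qed

lemma even_degrees_nonleaf_spoke_iff:
  assumes h: "h \<in> W - L"
  shows "{apex, h} \<in> A \<longleftrightarrow> odd (card {v \<in> used_leaves A. hub v = h})"
proof -
  let ?X = "{v \<in> used_leaves A. hub v = h}"
  let ?star = "(\<lambda>v. {h, v}) ` ?X"
  have fin: "finite ?star" using finite_used_leaves by simp
  have "{e \<in> A. h \<in> e} = A \<inter> {e \<in> cone. h \<in> e}" using subset by blast
  also have "\<dots> = (A \<inter> {{apex, h}}) \<union> ?star"
    unfolding cone_edges_at_nonleaf[OF h] used_leaves_def by blast
  finally have edges: "{e \<in> A. h \<in> e} = (A \<inter> {{apex, h}}) \<union> ?star" .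
  have "card ?star = card ?X" by (intro card_image) (auto simp: inj_on_def doubleton_eq_iff)
  moreover have "{apex, h} \<notin> ?star"
    using h apex_neq_vertex apex_neq_leaf unfolding used_leaves_def by (auto simp: doubleton_eq_iff)
  ultimately have "degree A h = card (A \<inter> {{apex, h}}) + card ?X"
    unfolding degree_def edges using fin by (subst card_Un_disjoint) auto
  moreover have "even (degree A h)" using even unfolding even_degrees_def by blast
  ultimately show ?thesis by (cases "{apex, h} \<in> A") simp_all
qed

end

lemma even_degrees_eq_if_used_leaves_eq:
  assumes A: "A \<subseteq> cone" "even_degrees A" and B: "B \<subseteq> cone" "even_degrees B"
    and eq: "used_leaves A = used_leaves B"
  shows "A = B"
proof -
  have "e \<in> A \<longleftrightarrow> e \<in> B" if e: "e \<in> cone" for e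
  proof -
    consider (spoke) v where "v \<in> W" "e = {apex, v}" | (star) v where "v \<in> L" "e = {hub v, v}"
      using e unfolding cone_def spokes_def star_edges_def by blast
    then show ?thesis
    proof cases
      case spoke
      then show ?thesis
        using even_degrees_leaf_spoke_iff[OF A] even_degrees_leaf_spoke_iff[OF B]
          even_degrees_nonleaf_spoke_iff[OF A] even_degrees_nonleaf_spoke_iff[OF B] eq
        by (cases "v \<in> L") simp_all
    next
      case star
      then show ?thesis using eq unfolding used_leaves_def by blast
    qed
  qed
  then show ?thesis using A(1) B(1) by blast
qed

lemma inj_on_used_leaves: "inj_on used_leaves (cycles cone)"
  using cycle_subset cycle_even_degrees
  by (intro inj_onI even_degrees_eq_if_used_leaves_eq)

context
  fixes C :: "'a set set"
  assumes cycle: "C \<in> cycles cone"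
begin

lemma cycle_leaf_spoke_iff: "v \<in> L \<Longrightarrow> {apex, v} \<in> C \<longleftrightarrow> v \<in> used_leaves C"
  using even_degrees_leaf_spoke_iff cycle_subset[OF cycle] cycle_even_degrees[OF cycle] .

lemma cycle_nonleaf_spoke_iff:
  "h \<in> W - L \<Longrightarrow> {apex, h} \<in> C \<longleftrightarrow> odd (card {v \<in> used_leaves C. hub v = h})"
  using even_degrees_nonleaf_spoke_iff cycle_subset[OF cycle] cycle_even_degrees[OF cycle] .

lemma cycle_card_spokes_le_2:
  assumes "\<And>x. x \<in> X \<Longrightarrow> {apex, x} \<in> C"
  shows "card X \<le> 2"
proof -
  have "finite C"
    using cycle_subset[OF cycle] simple_graph_finite_edges[OF simple_graph_cone] finite_subset by blast
  then have "card X \<le> card {e \<in> C. apex \<in> e}"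
    using assms by (intro card_inj_on_le[of "\<lambda>x. {apex, x}"]) (auto simp: inj_on_def doubleton_eq_iff)
  also have "\<dots> \<le> 2" using degree_cycle[OF cycle, of apex] unfolding degree_def by auto
  finally show ?thesis .
qed

lemma used_leaf_spoke: "v \<in> used_leaves C \<Longrightarrow> {apex, v} \<in> C"
  using cycle_leaf_spoke_iff unfolding used_leaves_def by blast

lemma used_leaves_eq_singleton:
  assumes h: "h \<in> W - L" "{apex, h} \<in> C"
  shows "\<exists>w\<in>L. hub w = h \<and> used_leaves C = {w}"
proof -
  have "{v \<in> used_leaves C. hub v = h} \<noteq> {}"
    using cycle_nonleaf_spoke_iff[OF h(1)] h(2) by (metis card.empty even_zero)
  then obtain w where w: "w \<in> used_leaves C" "hub w = h" by blast
  have "card (insert h (used_leaves C)) \<le> 2"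
    using h(2) used_leaf_spoke by (intro cycle_card_spokes_le_2) blast
  moreover have "h \<notin> used_leaves C" using h(1) unfolding used_leaves_def by blast
  ultimately have "card (used_leaves C) \<le> card {w}" using finite_used_leaves by simp
  then have "{w} = used_leaves C"
    using w(1) finite_used_leaves by (intro card_seteq) simp_all
  then show ?thesis using w unfolding used_leaves_def by blast
qed

lemma used_leaves_eq_pair:
  assumes v: "v \<in> used_leaves C"
  shows "\<exists>w\<in>L. hub w = hub v \<and> used_leaves C = {v, w}"
proof (cases "\<exists>w\<in>used_leaves C. w \<noteq> v \<and> hub w = hub v")
  case True
  then obtain w where w: "w \<in> used_leaves C" "w \<noteq> v" "hub w = hub v" by blast
  have "card (used_leaves C) \<le> card {v, w}"
    using cycle_card_spokes_le_2[of "used_leaves C"] used_leaf_spoke w(2) by simp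
  then have "{v, w} = used_leaves C"
    using v w(1) finite_used_leaves by (intro card_seteq) simp_all
  then show ?thesis using w unfolding used_leaves_def by blast
next
  case False
  then have "{w \<in> used_leaves C. hub w = hub v} = {v}" using v by blast
  then have "odd (card {w \<in> used_leaves C. hub w = hub v})" by simp
  moreover have vL: "v \<in> L" using v unfolding used_leaves_def by blast
  ultimately have "{apex, hub v} \<in> C" using cycle_nonleaf_spoke_iff hub_nonleaf by blast
  then have "used_leaves C = {v}" using used_leaves_eq_singleton[OF hub_nonleaf[OF vL]] v by auto
  then show ?thesis using vL by blast
qed

end

lemma card_cone_cycles_le:
  assumes e: "e \<in> cone" and star: "\<And>h. card {v \<in> L. hub v = h} \<le> k"
  shows "card {C \<in> cycles cone. e \<in> C} \<le> k"
proof -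
  let ?C = "{C \<in> cycles cone. e \<in> C}"
  have "\<exists>h g. used_leaves ` ?C \<subseteq> g ` {w \<in> L. hub w = h}"
  proof (cases "\<exists>v\<in>L. v \<in> e")
    case True
    then obtain v where v: "v \<in> L" "v \<in> e" by blast
    then have e_eq: "e = {apex, v} \<or> e = {hub v, v}" using e cone_edges_at_leaf by blast
    have "used_leaves C \<in> (\<lambda>w. {v, w}) ` {w \<in> L. hub w = hub v}" if "C \<in> ?C" for C
    proof -
      have C: "C \<in> cycles cone" "e \<in> C" using that by auto
      then have "v \<in> used_leaves C"
        using e_eq v(1) cycle_leaf_spoke_iff unfolding used_leaves_def by blast
      then show ?thesis using used_leaves_eq_pair[OF C(1)] by auto
    qed
    then show ?thesis by blast
  next
    case False
    then obtain h where h: "h \<in> W - L" "e = {apex, h}"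
      using e unfolding cone_def spokes_def star_edges_def by blast
    have "used_leaves C \<in> (\<lambda>w. {w}) ` {w \<in> L. hub w = h}" if "C \<in> ?C" for C
      using used_leaves_eq_singleton[of C, OF _ h(1)] that h(2) by auto
    then show ?thesis by blast
  qed
  then obtain h g where used: "used_leaves ` ?C \<subseteq> g ` {w \<in> L. hub w = h}" by iprover
  have "inj_on used_leaves ?C"
    using inj_on_used_leaves Collect_restrict by (rule inj_on_subset)
  then have "card ?C = card (used_leaves ` ?C)" by (rule card_image[symmetric])
  also have "\<dots> \<le> card {w \<in> L. hub w = h}"
    using finite_leaves by (intro surj_card_le[OF _ used]) simp
  also have "\<dots> \<le> k" by (rule star)
  finally show ?thesis .
qed

theorem k_cactus_cone:
  assumes "\<And>h. card {v \<in> L. hub v = h} \<le> k"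
  shows "k_cactus k (insert apex W) cone"
  unfolding k_cactus_def
  using simple_graph_cone connected_graph_cone card_cone_cycles_le[OF _ assms] by blast

end

section \<open>The extremal cacti\<close>

text \<open>
  The vertices below \<open>m\<close> are cut into consecutive blocks of \<open>k + 1\<close>, of which the last may be shorter;
  the first vertex of a block is the hub of its star.
\<close>

definition block_hub :: "nat \<Rightarrow> nat \<Rightarrow> nat" where
  "block_hub k v = v div Suc k * Suc k"

definition block_leaves :: "nat \<Rightarrow> nat \<Rightarrow> nat set" where
  "block_leaves k m = {v. v < m \<and> \<not> Suc k dvd v}"

lemma star_forest_cone_blocks: "star_forest_cone m {..<m} (block_leaves k m) (block_hub k)"
proof unfold_locales
  fix v assume "v \<in> block_leaves k m"
  moreover have "block_hub k v \<le> v" unfolding block_hub_def by (rule div_times_less_eq_dividend)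
  moreover have "Suc k dvd block_hub k v" unfolding block_hub_def by (rule dvd_triv_right)
  ultimately show "block_hub k v \<in> {..<m} - block_leaves k m" unfolding block_leaves_def by auto
qed (auto simp: block_leaves_def)

lemma card_block_leaves_at_hub_le: "card {v \<in> block_leaves k m. block_hub k v = h} \<le> k"
proof -
  have "h < v \<and> v \<le> h + k" if "\<not> Suc k dvd v" "block_hub k v = h" for v
  proof -
    have "v = h + v mod Suc k"
      unfolding that(2)[symmetric] block_hub_def by (rule div_mult_mod_eq[symmetric])
    moreover have "v mod Suc k < Suc k" by simp
    moreover have "v mod Suc k \<noteq> 0" using that(1) by (simp add: dvd_eq_mod_eq_0)
    ultimately show ?thesis by linarith
  qed
  then have "{v \<in> block_leaves k m. block_hub k v = h} \<subseteq> {h<..h + k}"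
    unfolding block_leaves_def by auto
  then have "card {v \<in> block_leaves k m. block_hub k v = h} \<le> card {h<..h + k}"
    by (intro card_mono) auto
  then show ?thesis by simp
qed

lemma mult_Suc_div_Suc:
  "k * Suc m div Suc k = k * m div Suc k + (if Suc k dvd m then 0 else 1)"
proof -
  define q r where "q = m div Suc k" and "r = m mod Suc k"
  have mult_div: "k * (Suc k * q + s) div Suc k = k * q + (s - 1)" if "s \<le> Suc k" for s
  proof (rule div_nat_eqI)
    show "Suc k * (k * q + (s - 1)) \<le> k * (Suc k * q + s)"
      using that by (cases s) (simp_all add: algebra_simps)
    show "k * (Suc k * q + s) < Suc k * Suc (k * q + (s - 1))"
      using that by (cases s) (simp_all add: algebra_simps)
  qed
  have "m = Suc k * q + r" unfolding q_def r_def by (rule mult_div_mod_eq[symmetric])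
  moreover have "Suc r \<le> Suc k" unfolding r_def by (simp add: Suc_le_eq)
  ultimately have "k * m div Suc k = k * q + (r - 1)" "k * Suc m div Suc k = k * q + r"
    using mult_div[of r] mult_div[of "Suc r"] by simp_all
  moreover have "Suc k dvd m \<longleftrightarrow> r = 0" unfolding r_def by (rule dvd_eq_mod_eq_0)
  ultimately show ?thesis by simp
qed

lemma card_block_leaves: "card (block_leaves k m) = k * m div Suc k"
proof (induction m)
  case 0
  show ?case by (simp add: block_leaves_def)
next
  case (Suc m)
  have "block_leaves k (Suc m) =
      (if Suc k dvd m then block_leaves k m else insert m (block_leaves k m))"
    by (auto simp: block_leaves_def less_Suc_eq)
  moreover have "finite (block_leaves k m)" "m \<notin> block_leaves k m" by (simp_all add: block_leaves_def)
  ultimately show ?case using Suc.IH by (simp add: mult_Suc_div_Suc del: mult_Suc_right)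
qed

theorem ex_tight_k_cactus:
  assumes "n \<ge> 1"
  obtains V :: "nat set" and E
  where "k_cactus k V E" "card V = n" "card E = (2 * k + 1) * (n - 1) div (k + 1)"
proof -
  define m where "m = n - 1"
  interpret star_forest_cone m "{..<m}" "block_leaves k m" "block_hub k"
    by (rule star_forest_cone_blocks)
  have "card cone = m + k * m div Suc k" by (simp add: card_cone card_block_leaves)
  also have "\<dots> = (k * m + m * Suc k) div Suc k" by (subst div_mult_self1) auto
  also have "k * m + m * Suc k = (2 * k + 1) * m" by (simp add: algebra_simps)
  finally have "card cone = (2 * k + 1) * (n - 1) div (k + 1)" unfolding m_def by simp
  moreover have "k_cactus k (insert m {..<m}) cone"
    using card_block_leaves_at_hub_le by (rule k_cactus_cone)
  moreover have "card (insert m {..<m}) = n" using assms unfolding m_def by simp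
  ultimately show thesis using that by blast
qed

lemma floor_cactus_bound:
  assumes "n \<ge> 1"
  shows "\<lfloor>(2 * real k + 1) * (real n - 1) / (real k + 1)\<rfloor> = int ((2 * k + 1) * (n - 1) div (k + 1))"
proof -
  have "(2 * real k + 1) * (real n - 1) / (real k + 1) = real ((2 * k + 1) * (n - 1)) / real (k + 1)"
    using assms by (cases n) (simp_all add: algebra_simps)
  then show ?thesis by (simp only: floor_divide_of_nat_eq)
qed

theorem theorem3:
  fixes k :: nat
  assumes "k \<in> {2, 3}"
  shows "(\<forall>(V :: 'a set) E n. k_cactus k V E \<and> card V = n \<longrightarrow>
            int (card E) \<le> \<lfloor>(2 * real k + 1) * (real n - 1) / (real k + 1)\<rfloor>) \<and>
         (\<forall>n::nat. n \<ge> 1 \<longrightarrow>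
            (\<exists>(V :: nat set) E. k_cactus k V E \<and> card V = n \<and>
               int (card E) = \<lfloor>(2 * real k + 1) * (real n - 1) / (real k + 1)\<rfloor>))"
proof (intro conjI allI impI)
  fix V :: "'a set" and E n
  assume "k_cactus k V E \<and> card V = n"
  then have E: "simple_graph V E" "V \<noteq> {}" "\<And>e. e \<in> E \<Longrightarrow> card {C \<in> cycles E. e \<in> C} \<le> k"
    and n: "n = card V"
    by (auto simp: k_cactus_def connected_graph_def)
  then have "n \<ge> 1" by (simp add: simple_graph_def card_gt_0_iff Suc_le_eq)
  have "(k + 1) * card E \<le> (2 * k + 1) * (n - 1)"
    unfolding n using assms by (intro card_edges_le_if_few_cycles[OF E]) auto
  then have "card E \<le> (2 * k + 1) * (n - 1) div (k + 1)"
    by (simp add: less_eq_div_iff_mult_less_eq mult.commute)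
  then show "int (card E) \<le> \<lfloor>(2 * real k + 1) * (real n - 1) / (real k + 1)\<rfloor>"
    unfolding floor_cactus_bound[OF \<open>n \<ge> 1\<close>] by (simp only: of_nat_le_iff)
next
  fix n :: nat assume "n \<ge> 1"
  then show "\<exists>(V :: nat set) E. k_cactus k V E \<and> card V = n \<and>
      int (card E) = \<lfloor>(2 * real k + 1) * (real n - 1) / (real k + 1)\<rfloor>"
    using ex_tight_k_cactus[of n k] unfolding floor_cactus_bound[OF \<open>n \<ge> 1\<close>] by metis
qed

end
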